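(* For every $n\in\mathbf{N}=\{0,1,2,\ldots\}$, the number of disjoint Schröder $n$-families is $2^{\binom{n}{2}}$.
   Context: A Schröder-type path from $p$ to $q$ (with $p,q\in\mathbf{Z}\times\mathbf{Z}$) is a sequence $P=(p_0,p_1,\ldots,p_k)$ with $k\in\mathbf{N}$, $p_i\in\mathbf{Z}\times\mathbf{Z}$ for $0\le i\le k$, $p_0=p$, $p_k=q$, and $p_{i+1}-p_i\in\{(0,+1),(-1,+1),(-1,0)\}$ for $0\le i<k$. Its support is $\operatorname{supp}(P)=\{p_0,\ldots,p_k\}$. For $n\in\mathbf{N}$, an $n$-family is an $n$-tuple $(P_0,P_1,\ldots,P_{n-1})$ where, for each $0\le i<n$, $P_i$ is a Schröder-type path from $(i,0)$ to $(0,i)$. It is disjoint if the sets $\operatorname{supp}(P_0),\ldots,\operatorname{supp}(P_{n-1})$ are pairwise disjoint. It is a Schröder $n$-family if for each $i$ and each point $(k,l)\in\operatorname{supp}(P_i)$ one has $k+l\ge i$. A disjoint Schröder $n$-family is an $n$-family that is both disjoint and a Schröder $n$-family. *)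

theory Defs
  imports Main "HOL-Library.Product_Plus" "HOL-Library.Disjoint_Sets"
begin

type_synonym point = "int \<times> int"

(* The sequence (p_0, ..., p_k) is the list [p_0, ..., p_k] of length k + 1;
   k = 0 is allowed, so a single point is a path from itself to itself. *)
definition schroeder_type_path :: "point \<Rightarrow> point \<Rightarrow> point list \<Rightarrow> bool" where
  "schroeder_type_path p q P \<longleftrightarrow>
     P \<noteq> [] \<and> hd P = p \<and> last P = q \<and>
     (\<forall>i. Suc i < length P \<longrightarrow> P ! Suc i - P ! i \<in> {(0, 1), (- 1, 1), (- 1, 0)})"

definition supp :: "point list \<Rightarrow> point set" where
  "supp P = set P"

definition n_family :: "nat \<Rightarrow> point list list \<Rightarrow> bool" where
  "n_family n F \<longleftrightarrow>
     length F = n \<and>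
     (\<forall>i<n. schroeder_type_path (int i, 0) (0, int i) (F ! i))"

(* Disjointness is over distinct indices, so repeated paths are excluded. *)
definition disjoint_n_family :: "nat \<Rightarrow> point list list \<Rightarrow> bool" where
  "disjoint_n_family n F \<longleftrightarrow>
     n_family n F \<and> disjoint_family_on (\<lambda>i. supp (F ! i)) {..<n}"

definition schroeder_n_family :: "nat \<Rightarrow> point list list \<Rightarrow> bool" where
  "schroeder_n_family n F \<longleftrightarrow>
     n_family n F \<and> (\<forall>i<n. \<forall>(k, l)\<in>supp (F ! i). k + l \<ge> int i)"

definition disjoint_schroeder_n_family :: "nat \<Rightarrow> point list list \<Rightarrow> bool" where
  "disjoint_schroeder_n_family n F \<longleftrightarrow>
     disjoint_n_family n F \<and> schroeder_n_family n F"

end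

theory Submission
  imports Defs "HOL-Library.FuncSet" "Jordan_Normal_Form.Determinant"
begin

text \<open>
  For weakly increasing starting abscissas \<open>A 0, \<dots>, A (m - 1)\<close>, the number of disjoint families of
  paths from \<open>(A i, 0)\<close> to \<open>(0, i)\<close> is \<open>2 ^ (m choose 2) * det (A i choose j)\<close>. Removing the bottom row
  determines the path with index 0 and leaves each path \<open>i + 1\<close> with an abscissa \<open>b\<close>,
  \<open>A i < b \<le> A (i + 1)\<close>, at which it leaves the row, and an independent choice of the abscissa \<open>b\<close> or
  \<open>b - 1\<close> at which it enters the next row. By multilinearity, summing the smaller determinant over all
  these choices telescopes each row, and column operations turn the result into \<open>2 ^ m\<close> times the larger
  determinant. For \<open>A i = i\<close> the determinant is unitriangular. The Schroeder condition is automatic: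
  existence of the \<open>b\<close>'s forces \<open>A i \<ge> i\<close>, which bounds the points in the bottom row.
\<close>

section \<open>Determinants of binomial coefficients\<close>

definition binom_det :: "nat \<Rightarrow> (nat \<Rightarrow> nat) \<Rightarrow> int" where
  "binom_det m A = det (mat m m (\<lambda>(i, j). int (A i choose j)))"

text \<open>Multilinearity in the rows: row \<open>i\<close> depends on \<open>c\<close> only
  through \<open>c i\<close>. In the Leibniz expansion the sum over all choices turns each product
  into a product of sums.\<close>

lemma sum_det_PiE:
  fixes f :: "nat \<Rightarrow> 'b \<Rightarrow> nat \<Rightarrow> 'a :: comm_ring_1"
  assumes "\<And>i. i < m \<Longrightarrow> finite (C i)"
  shows "(\<Sum>c \<in> PiE {..<m} C. det (mat m m (\<lambda>(i, j). f i (c i) j))) =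
    det (mat m m (\<lambda>(i, j). \<Sum>x\<in>C i. f i x j))"
proof -
  have "(\<Sum>c \<in> PiE {..<m} C. det (mat m m (\<lambda>(i, j). f i (c i) j))) =
    (\<Sum>c \<in> PiE {..<m} C. \<Sum>p \<in> {p. p permutes {0..<m}}.
      signof p * (\<Prod>i = 0..<m. f i (c i) (p i)))"
    by (intro sum.cong refl, subst det_def'[of _ m])
      (auto intro!: sum.cong prod.cong simp: permutes_in_image)
  also have "\<dots> = (\<Sum>p \<in> {p. p permutes {0..<m}}.
      signof p * (\<Sum>c \<in> PiE {..<m} C. \<Prod>i = 0..<m. f i (c i) (p i)))"
    by (subst sum.swap) (simp add: sum_distrib_left)
  also have "\<dots> = (\<Sum>p \<in> {p. p permutes {0..<m}}.
      signof p * (\<Prod>i = 0..<m. \<Sum>x\<in>C i. f i x (p i)))"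
    using assms by (subst prod_sum_PiE) (simp_all add: atLeast0LessThan)
  also have "\<dots> = det (mat m m (\<lambda>(i, j). \<Sum>x\<in>C i. f i x j))"
    by (subst det_def'[of _ m]) (auto intro!: sum.cong prod.cong simp: permutes_in_image)
  finally show ?thesis .
qed

text \<open>Subtracting from each row of the bordered matrix its predecessor turns the column of
  ones into the first unit vector. Laplace expansion along that column leaves the matrix of
  differences.\<close>

lemma det_row_differences:
  fixes h :: "nat \<Rightarrow> nat \<Rightarrow> 'a :: comm_ring_1"
  shows "det (mat m m (\<lambda>(i, j). h (Suc i) j - h i j)) =
    det (mat (Suc m) (Suc m) (\<lambda>(i, j). case j of 0 \<Rightarrow> 1 | Suc j \<Rightarrow> h i j))"
proof -
  let ?n = "Suc m"
  define Q where "Q = mat ?n ?n (\<lambda>(i, j). case j of 0 \<Rightarrow> 1 | Suc j \<Rightarrow> h i j)"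
  define L :: "'a mat" where
    "L = mat ?n ?n (\<lambda>(i, k). if k = i then 1 else if Suc k = i then -1 else 0)"
  have carr: "Q \<in> carrier_mat ?n ?n" "L \<in> carrier_mat ?n ?n"
    by (auto simp: Q_def L_def)
  have "det L = prod_list (diag_mat L)"
    by (rule det_lower_triangular[OF _ carr(2)]) (auto simp: L_def)
  also have "\<dots> = 1"
    by (simp add: prod_list_diag_prod L_def)
  finally have "det (L * Q) = det Q"
    by (simp add: det_mult[OF carr(2,1)])
  have ent: "(L * Q) $$ (i, j) = Q $$ (i, j) - (if i = 0 then 0 else Q $$ (i - 1, j))"
    if "i < ?n" "j < ?n" for i j
  proof -
    have "(L * Q) $$ (i, j) = (\<Sum>k<?n. L $$ (i, k) * Q $$ (k, j))"
      using that carr by (simp add: scalar_prod_def atLeast0LessThan)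
    \<comment> \<open>For \<open>i = 0\<close> the truncated \<open>i - 1\<close> is again 0, so the
      inner conditional must suppress the predecessor term.\<close>
    also have "\<dots> = (\<Sum>k<?n. (if k = i then Q $$ (k, j) else 0)
        - (if k = i - 1 then (if i = 0 then 0 else Q $$ (k, j)) else 0))"
      using that by (intro sum.cong refl) (auto simp: L_def)
    also have "\<dots> = Q $$ (i, j) - (if i = 0 then 0 else Q $$ (i - 1, j))"
      using that by (simp add: sum_subtractf del: sum.lessThan_Suc)
    finally show ?thesis .
  qed
  have LQ: "L * Q \<in> carrier_mat ?n ?n"
    using carr by simp
  have "det (L * Q) = (\<Sum>i<?n. (L * Q) $$ (i, 0) * cofactor (L * Q) i 0)"
    by (rule laplace_expansion_column[OF LQ]) simp
  also have "\<dots> = (\<Sum>i<?n. if i = 0 then cofactor (L * Q) i 0 else 0)"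
  proof (intro sum.cong refl)
    fix i assume "i \<in> {..<?n}"
    then show "(L * Q) $$ (i, 0) * cofactor (L * Q) i 0 = (if i = 0 then cofactor (L * Q) i 0 else 0)"
      by (subst ent) (auto simp: Q_def)
  qed
  also have "\<dots> = cofactor (L * Q) 0 0"
    by (simp del: sum.lessThan_Suc)
  also have "\<dots> = det (mat_delete (L * Q) 0 0)"
    by (simp add: cofactor_def)
  also have "mat_delete (L * Q) 0 0 = mat m m (\<lambda>(i, j). h (Suc i) j - h i j)"
  proof (rule eq_matI, goal_cases)
    case (1 i j)
    then have ij: "Suc i < ?n" "Suc j < ?n" by auto
    have "mat_delete (L * Q) 0 0 $$ (i, j) = (L * Q) $$ (Suc i, Suc j)"
      using ij carr by (simp add: mat_delete_def del: index_mult_mat(1))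
    also have "\<dots> = h (Suc i) j - h i j"
      by (subst ent[OF ij]) (use ij in \<open>simp add: Q_def\<close>)
    finally show ?case
      using 1 by simp
  qed (use carr in auto)
  finally show ?thesis
    using \<open>det (L * Q) = det Q\<close> by (simp add: Q_def)
qed

text \<open>Each column with \<open>j > 0\<close> is twice column \<open>j\<close> plus column
  \<open>j - 1\<close> of the binomial matrix. This is right multiplication by an upper bidiagonal
  \<open>U\<close> with diagonal 1, 2, ..., 2. For \<open>m = 0\<close> truncated subtraction gives
  the correct factor 1.\<close>

lemma det_binom_sums:
  "det (mat m m (\<lambda>(i, j). case j of 0 \<Rightarrow> 1 | Suc j' \<Rightarrow>
      2 * int (A i choose Suc j') + int (A i choose j'))) = 2 ^ (m - 1) * binom_det m A"
proof -
  define P where "P = mat m m (\<lambda>(i, j). int (A i choose j))"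
  define U :: "int mat" where "U = mat m m (\<lambda>(k, j).
    if k = j then (if j = 0 then 1 else 2) else if Suc k = j then 1 else 0)"
  have carr: "P \<in> carrier_mat m m" "U \<in> carrier_mat m m"
    by (auto simp: P_def U_def)
  have "det U = prod_list (diag_mat U)"
    by (rule det_upper_triangular[OF _ carr(2)]) (auto simp: U_def upper_triangular_def)
  also have "\<dots> = (\<Prod>i<m. if i = 0 then 1 else 2)"
    by (simp add: prod_list_diag_prod U_def atLeast0LessThan)
  also have "\<dots> = 2 ^ (m - 1)"
    by (cases m) (simp_all add: prod.lessThan_Suc_shift del: prod.lessThan_Suc)
  finally have "det (P * U) = 2 ^ (m - 1) * binom_det m A"
    unfolding binom_det_def P_def[symmetric] by (simp add: det_mult[OF carr])
  moreover have "P * U = mat m m (\<lambda>(i, j). case j of 0 \<Rightarrow> 1 | Suc j' \<Rightarrow>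
      2 * int (A i choose Suc j') + int (A i choose j'))"
  proof (rule eq_matI, goal_cases)
    case (1 i j)
    then have ij: "i < m" "j < m" by auto
    have "(P * U) $$ (i, j) = (\<Sum>k<m. P $$ (i, k) * U $$ (k, j))"
      using ij carr by (simp add: scalar_prod_def atLeast0LessThan)
    also have "\<dots> = (\<Sum>k<m. (if k = j then int (A i choose k) * (if j = 0 then 1 else 2) else 0)
        + (if k = j - 1 then (if j = 0 then 0 else int (A i choose k)) else 0))"
      using ij by (intro sum.cong refl) (auto simp: P_def U_def)
    also have "\<dots> = int (A i choose j) * (if j = 0 then 1 else 2)
        + (if j = 0 then 0 else int (A i choose (j - 1)))"
      using ij by (simp add: sum.distrib)
    finally show ?case
      using ij by (simp split: nat.split)
  qed (use carr in auto)
  ultimately show ?thesis by simp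
qed

lemma binom_det_id: "binom_det m (\<lambda>i. i) = 1"
proof -
  have "binom_det m (\<lambda>i. i) = prod_list (diag_mat (mat m m (\<lambda>(i, j). int (i choose j))))"
    unfolding binom_det_def by (rule det_lower_triangular[where n = m]) (auto simp: binomial_eq_0)
  then show ?thesis
    by (simp add: prod_list_diag_prod)
qed

section \<open>Summing binomial determinants over all crossings of a row\<close>

text \<open>A path that leaves the bottom row at abscissa \<open>b\<close> enters the next row at \<open>b\<close> or \<open>b - 1\<close>;
  a pair \<open>(b, x)\<close> records both abscissas.\<close>

definition crossings :: "nat \<Rightarrow> nat \<Rightarrow> (nat \<times> nat) set" where
  "crossings a a' = (SIGMA b:{a<..a'}. {b, b - 1})"

lemma finite_crossings [simp]: "finite (crossings a a')"
  by (auto simp: crossings_def)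

text \<open>By Pascal's rule, \<open>(b choose j) + ((b - 1) choose j)\<close> is the increment of
  \<open>2 * (b choose Suc j) + (b choose j)\<close> from \<open>b - 1\<close> to \<open>b\<close>,
  so the sum telescopes.\<close>

lemma sum_crossings:
  assumes "a \<le> a'"
  shows "(\<Sum>p\<in>crossings a a'. int (snd p choose j)) =
    (2 * int (a' choose Suc j) + int (a' choose j)) - (2 * int (a choose Suc j) + int (a choose j))"
proof -
  have "(\<Sum>p\<in>crossings a a'. int (snd p choose j)) =
    (\<Sum>b\<in>{a<..a'}. \<Sum>x\<in>{b, b - 1}. int (x choose j))"
    unfolding crossings_def by (subst sum.Sigma) (auto intro: sum.cong)
  \<comment> \<open>Since \<open>b > a\<close> forces \<open>b > 0\<close>, the abscissas
    \<open>b\<close> and \<open>b - 1\<close> are distinct and both terms count.\<close>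
  also have "\<dots> = (\<Sum>b\<in>{a<..a'}. int (b choose j) + int ((b - 1) choose j))"
    by (intro sum.cong refl) auto
  also have "\<dots> =
    (2 * int (a' choose Suc j) + int (a' choose j)) - (2 * int (a choose Suc j) + int (a choose j))"
    using assms
  proof (induction a' rule: dec_induct)
    case (step n)
    have "{a<..Suc n} = insert (Suc n) {a<..n}"
      using step.hyps by auto
    then show ?case
      using step.IH by (cases j) (simp_all)
  qed simp
  finally show ?thesis .
qed

text \<open>The algebraic counterpart of removing one row of a path family: it supplies the
  recurrence for the count.\<close>

lemma sum_binom_det_crossings:
  assumes "\<And>i. i < m \<Longrightarrow> A i \<le> A (Suc i)"
  shows "(\<Sum>c \<in> PiE {..<m} (\<lambda>i. crossings (A i) (A (Suc i))). binom_det m (\<lambda>i. snd (c i))) =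
    2 ^ m * binom_det (Suc m) A"
proof -
  define h where "h i j = 2 * int (A i choose Suc j) + int (A i choose j)" for i j
  have "(\<Sum>c \<in> PiE {..<m} (\<lambda>i. crossings (A i) (A (Suc i))). binom_det m (\<lambda>i. snd (c i))) =
    det (mat m m (\<lambda>(i, j). \<Sum>p\<in>crossings (A i) (A (Suc i)). int (snd p choose j)))"
    unfolding binom_det_def by (rule sum_det_PiE) simp
  also have "mat m m (\<lambda>(i, j). \<Sum>p\<in>crossings (A i) (A (Suc i)). int (snd p choose j)) =
    mat m m (\<lambda>(i, j). h (Suc i) j - h i j)"
    using assms by (intro cong_mat) (auto simp: sum_crossings h_def)
  also have "det (mat m m (\<lambda>(i, j). h (Suc i) j - h i j)) =
    det (mat (Suc m) (Suc m) (\<lambda>(i, j). case j of 0 \<Rightarrow> 1 | Suc j \<Rightarrow> h i j))"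
    by (rule det_row_differences)
  finally show ?thesis
    using det_binom_sums[of "Suc m" A] by (simp add: h_def cong: nat.case_cong)
qed

section \<open>Peeling off the bottom row\<close>

definition bottom_row :: "nat \<Rightarrow> nat \<Rightarrow> point list" where
  "bottom_row a b = map (\<lambda>x. (int x, 0)) (rev [b..<Suc a])"

definition lift :: "point list \<Rightarrow> point list" where
  "lift = map (\<lambda>(x, y). (x, y + 1))"

lemma schroeder_type_path_iff:
  "schroeder_type_path p q P \<longleftrightarrow> P \<noteq> [] \<and> hd P = p \<and> last P = q \<and>
     successively (\<lambda>u v. v - u \<in> {(0, 1), (- 1, 1), (- 1, 0)}) P"
  by (simp add: schroeder_type_path_def successively_conv_nth)

lemma schroeder_type_path_Nil [simp]: "\<not> schroeder_type_path p q []"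
  by (simp add: schroeder_type_path_iff)

lemma schroeder_type_path_Cons:
  "schroeder_type_path p q (r # P) \<longleftrightarrow> r = p \<and>
     (P = [] \<and> p = q \<or> (\<exists>p'. p' - p \<in> {(0, 1), (- 1, 1), (- 1, 0)} \<and> schroeder_type_path p' q P))"
  by (cases P) (auto simp: schroeder_type_path_iff)

text \<open>No step moves right or down, so a path stays in the rectangle spanned by its
  endpoints.\<close>

lemma schroeder_type_path_monotone:
  "schroeder_type_path p q P \<Longrightarrow> r \<in> set P \<Longrightarrow>
     fst q \<le> fst r \<and> fst r \<le> fst p \<and> snd p \<le> snd r \<and> snd r \<le> snd q"
proof (induction P arbitrary: p r)
  case (Cons u P)
  show ?case
  proof (cases "P = []")
    case True
    then show ?thesis using Cons.prems by (auto simp: schroeder_type_path_Cons)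
  next
    case False
    then obtain p' where p': "p' - p \<in> {(0, 1), (- 1, 1), (- 1, 0)}" "schroeder_type_path p' q P"
      and u: "u = p"
      using Cons.prems(1) by (auto simp: schroeder_type_path_Cons)
    have "p' \<in> set P" using p'(2) by (auto simp: schroeder_type_path_iff)
    then have "fst q \<le> fst p' \<and> snd p' \<le> snd q"
      using Cons.IH[OF p'(2)] by blast
    moreover have "fst p' \<le> fst p \<and> snd p \<le> snd p'"
      using p'(1) by (cases p; cases p') auto
    ultimately show ?thesis
      using Cons.IH[OF p'(2), of r] Cons.prems(2) u by auto
  qed
qed simp

lemma schroeder_type_path_lift:
  "schroeder_type_path (x, y + 1) (x', y' + 1) (lift P) \<longleftrightarrow> schroeder_type_path (x, y) (x', y') P"
proof -
  have "successively (\<lambda>u v. v - u \<in> {(0, 1), (- 1, 1), (- 1, 0)}) (lift P) \<longleftrightarrow>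
    successively (\<lambda>u v. v - u \<in> {(0, 1), (- 1, 1), (- 1, 0)}) P"
    unfolding lift_def successively_map
    by (intro arg_cong2[of _ _ _ _ successively] ext) (auto split: prod.splits)
  then show ?thesis
    by (cases "P = []") (auto simp: schroeder_type_path_iff lift_def hd_map last_map split: prod.splits)
qed

lemma lift_inverse: "lift (map (\<lambda>(x, y). (x, y - 1)) P) = P"
  by (induction P) (auto simp: lift_def)

lemma set_lift: "set (lift P) = (\<lambda>(x, y). (x, y + 1)) ` set P"
  by (simp add: lift_def)

lemma set_bottom_row: "set (bottom_row a b) = (\<lambda>x. (int x, 0)) ` {b..a}"
  by (auto simp: bottom_row_def)

lemma bottom_row_refl [simp]: "bottom_row a a = [(int a, 0)]"
  by (simp add: bottom_row_def)

lemma bottom_row_Suc: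
  "b \<le> a \<Longrightarrow> bottom_row (Suc a) b = (int (Suc a), 0) # bottom_row a b"
  by (simp add: bottom_row_def)

lemma schroeder_type_path_bottom_row_append:
  assumes "b \<le> a" "schroeder_type_path (int x, 1) q P" "int x \<in> {int b, int b - 1}"
  shows "schroeder_type_path (int a, 0) q (bottom_row a b @ P)"
  using assms(1)
proof (induction a rule: dec_induct)
  case base
  have "(int x, 1) - (int b, 0) \<in> {(0, 1), (- 1, 1), (- 1, 0 :: int)}"
    using assms(3) by auto
  then show ?case
    using assms(2) unfolding bottom_row_refl append_Cons append_Nil schroeder_type_path_Cons by blast
next
  case (step n)
  then show ?case
    by (auto simp: bottom_row_Suc schroeder_type_path_Cons intro!: exI[of _ "(int n, 0)"])
qed

text \<open>The endpoint has ordinate 0, so only left steps are possible. Hence the path with index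
  0 is unique.\<close>

lemma schroeder_type_path_bottom:
  assumes "schroeder_type_path (int a, 0) (0, 0) P"
  shows "P = bottom_row a 0"
  using assms
proof (induction P arbitrary: a)
  case (Cons r P)
  show ?case
  proof (cases "P = []")
    case True
    then show ?thesis using Cons.prems by (simp add: schroeder_type_path_Cons)
  next
    case False
    then obtain p where p: "p - (int a, 0) \<in> {(0, 1), (- 1, 1), (- 1, 0)}"
      "schroeder_type_path p (0, 0) P" "r = (int a, 0)"
      using Cons.prems unfolding schroeder_type_path_Cons by blast
    have "p \<in> set P" using p(2) by (auto simp: schroeder_type_path_iff)
    then have "0 \<le> fst p" "snd p \<le> 0"
      using schroeder_type_path_monotone[OF p(2)] by auto
    then have "p = (int (a - 1), 0)" "0 < a" using p(1) by (cases p; auto)+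
    then show ?thesis
      using Cons.IH[of "a - 1"] p bottom_row_Suc[of 0 "a - 1"] by simp
  qed
qed simp

lemma schroeder_type_path_bottom_row:
  "schroeder_type_path (int a, 0) (0, 0) (bottom_row a 0)"
proof (induction a)
  case 0
  then show ?case by (simp add: schroeder_type_path_Cons zero_prod_def)
next
  case (Suc a)
  then show ?case
    by (auto simp: bottom_row_Suc schroeder_type_path_Cons intro!: exI[of _ "(int a, 0)"])
qed

text \<open>The path must leave the bottom row, since it ends at ordinate \<open>i + 1\<close>. Its
  last abscissa there is \<open>b\<close>, and a vertical or diagonal step enters the next row at
  \<open>x\<close>.\<close>

lemma schroeder_type_path_decompose:
  assumes "schroeder_type_path (int a, 0) (0, int (Suc i)) P"
  obtains b x P' where "b \<le> a" "int x \<in> {int b, int b - 1}"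
    "schroeder_type_path (int x, 0) (0, int i) P'" "P = bottom_row a b @ lift P'"
  using assms
proof (induction P arbitrary: a thesis)
  case (Cons r P)
  obtain p where p: "p - (int a, 0) \<in> {(0, 1), (- 1, 1), (- 1, 0)}"
    "schroeder_type_path p (0, int (Suc i)) P" "r = (int a, 0)"
    using Cons.prems(2) unfolding schroeder_type_path_Cons by force
  have "p \<in> set P" using p(2) by (auto simp: schroeder_type_path_iff)
  then have nonneg: "0 \<le> fst p"
    using schroeder_type_path_monotone[OF p(2)] by auto
  show ?case
  proof (cases "snd p = 0")
    case True
    then have pa: "p = (int (a - 1), 0)" "0 < a" using p(1) nonneg by (cases p; auto)+
    obtain b x P' where *: "b \<le> a - 1" "int x \<in> {int b, int b - 1}"
      "schroeder_type_path (int x, 0) (0, int i) P'" "P = bottom_row (a - 1) b @ lift P'"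
      using Cons.IH p(2) pa by metis
    then have "r # P = bottom_row a b @ lift P'"
      using bottom_row_Suc[of b "a - 1"] pa p(3) by simp
    then show ?thesis
      using * by (intro Cons.prems(1)[of b x P']) auto
  next
    \<comment> \<open>The first step already leaves the row, so \<open>b = a\<close> and the whole
      remainder is a lifted path.\<close>
    case False
    define P' where "P' = map (\<lambda>(x, y). (x, y - 1)) P"
    have P: "P = lift P'" by (simp add: P'_def lift_inverse)
    have pa: "p = (int (nat (fst p)), 0 + 1)" "fst p \<in> {int a, int a - 1}"
      using p(1) False nonneg by (cases p; auto)+
    have "schroeder_type_path (int (nat (fst p)), 0) (0, int i) P'"
      using p(2) pa(1) P schroeder_type_path_lift[of "int (nat (fst p))" 0 0 "int i" P']
      by (simp add: add.commute)
    then show ?thesis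
      using pa nonneg P p(3) by (intro Cons.prems(1)[of a "nat (fst p)" P']) auto
  qed
qed simp

text \<open>The lifted part starts at ordinate 1, so the bottom row is the maximal initial segment
  of ordinate 0. Its length determines \<open>b\<close>, and the head of the remainder determines
  \<open>x\<close>.\<close>

lemma bottom_row_append_lift_inj:
  assumes "bottom_row a b @ lift P = bottom_row a b' @ lift P'"
    "schroeder_type_path (x, 0) q P" "schroeder_type_path (x', 0) q' P'" "b \<le> a" "b' \<le> a"
  shows "b = b' \<and> P = P' \<and> x = x'"
proof -
  have tw: "takeWhile (\<lambda>r. snd r = 0) (bottom_row a b @ lift P) = bottom_row a b"
    if "schroeder_type_path (x, 0) q P" for b x q P
    using that by (subst takeWhile_append2; cases P)
      (auto simp: set_bottom_row lift_def schroeder_type_path_Cons)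
  have "bottom_row a b = bottom_row a b'"
    using tw[OF assms(2), of b] tw[OF assms(3), of b'] assms(1) by simp
  then have "length (bottom_row a b) = length (bottom_row a b')" by simp
  then have b: "b = b'" using assms(4,5) by (simp add: bottom_row_def)
  then have "lift P = lift P'" using assms(1) by simp
  then have "P = P'"
    by (auto simp: lift_def inj_on_def dest!: map_injective)
  then show ?thesis
    using b assms(2,3) by (auto simp: schroeder_type_path_iff)
qed

section \<open>Disjoint families of paths with prescribed starting points\<close>

text \<open>Starting abscissas are left general because removing a row changes them while the
  endpoints keep the form \<open>(0, i)\<close>. Extensional functions make families equal once they
  agree below \<open>m\<close>.\<close>

definition disjoint_paths :: "nat \<Rightarrow> (nat \<Rightarrow> nat) \<Rightarrow> (nat \<Rightarrow> point list) set" where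
  "disjoint_paths m A =
    {F \<in> PiE {..<m} (\<lambda>i. {P. schroeder_type_path (int (A i), 0) (0, int i) P}).
      disjoint_family_on (\<lambda>i. supp (F i)) {..<m}}"

section \<open>Attaching a bottom row to a smaller family\<close>

definition attach_row ::
  "nat \<Rightarrow> (nat \<Rightarrow> nat) \<Rightarrow> (nat \<Rightarrow> nat \<times> nat) \<Rightarrow> (nat \<Rightarrow> point list) \<Rightarrow> nat \<Rightarrow> point list" where
  "attach_row m A c F = (\<lambda>i\<in>{..<Suc m}. case i of
      0 \<Rightarrow> bottom_row (A 0) 0
    | Suc i' \<Rightarrow> bottom_row (A i) (fst (c i')) @ lift (F i'))"

lemma attach_row_0 [simp]: "attach_row m A c F 0 = bottom_row (A 0) 0"
  by (simp add: attach_row_def)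

lemma attach_row_Suc [simp]:
  "i < m \<Longrightarrow> attach_row m A c F (Suc i) = bottom_row (A (Suc i)) (fst (c i)) @ lift (F i)"
  by (simp add: attach_row_def)

lemma mono_upto:
  fixes A :: "nat \<Rightarrow> nat"
  assumes "\<And>i. i < m \<Longrightarrow> A i \<le> A (Suc i)" and "i \<le> j" "j \<le> m"
  shows "A i \<le> A j"
  using assms(2,3)
proof (induction j rule: dec_induct)
  case (step n)
  then show ?case using assms(1)[of n] by simp
qed simp

lemma disjoint_pathsD:
  assumes "F \<in> disjoint_paths m A" "i < m"
  shows "schroeder_type_path (int (A i), 0) (0, int i) (F i)"
  using assms by (auto simp: disjoint_paths_def)

lemma disjoint_paths_disjointD:
  assumes "F \<in> disjoint_paths m A" "i < m" "j < m" "r \<in> set (F i)" "r \<in> set (F j)"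
  shows "i = j"
  using assms by (auto simp: disjoint_paths_def disjoint_family_on_def supp_def)

lemma crossingsD:
  assumes "p \<in> crossings a a'"
  shows "a < fst p" "fst p \<le> a'" "int (snd p) \<in> {int (fst p), int (fst p) - 1}"
  using assms by (auto simp: crossings_def)

lemma snd_nonneg_schroeder_type_path:
  "schroeder_type_path (x, 0) q P \<Longrightarrow> (k, l) \<in> set P \<Longrightarrow> 0 \<le> l"
  using schroeder_type_path_monotone[of "(x, 0)" q P "(k, l)"] by simp

text \<open>The new bottom segments are disjoint because path \<open>i + 1\<close> leaves the row
  strictly to the right of \<open>A i\<close>. Above that row, disjointness is inherited from
  \<open>F\<close>.\<close>

lemma attach_row_in_disjoint_paths:
  assumes mono: "\<And>i. i < m \<Longrightarrow> A i \<le> A (Suc i)"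
    and c: "c \<in> PiE {..<m} (\<lambda>i. crossings (A i) (A (Suc i)))"
    and F: "F \<in> disjoint_paths m (\<lambda>i. snd (c i))"
  shows "attach_row m A c F \<in> disjoint_paths (Suc m) A"
proof -
  let ?G = "attach_row m A c F"
  have c': "A i < fst (c i)" "fst (c i) \<le> A (Suc i)"
    "int (snd (c i)) \<in> {int (fst (c i)), int (fst (c i)) - 1}" if "i < m" for i
    using crossingsD[OF PiE_mem[OF c]] that by simp_all
  have path: "schroeder_type_path (int (A i), 0) (0, int i) (?G i)" if "i < Suc m" for i
  proof (cases i)
    case 0
    then show ?thesis by (simp add: schroeder_type_path_bottom_row)
  next
    case (Suc i')
    then have i': "i' < m" using that by simp
    have "schroeder_type_path (int (snd (c i')), 1) (0, int (Suc i')) (lift (F i'))"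
      using disjoint_pathsD[OF F i'] schroeder_type_path_lift[of _ 0 0 "int i'"]
      by (simp add: add.commute)
    then have "schroeder_type_path (int (A i), 0) (0, int (Suc i'))
        (bottom_row (A (Suc i')) (fst (c i')) @ lift (F i'))"
      unfolding Suc using c'[OF i'] by (intro schroeder_type_path_bottom_row_append) auto
    then show ?thesis using Suc i' by simp
  qed
  have disj: "r \<notin> set (?G i) \<or> r \<notin> set (?G j)" if "i < j" "j < Suc m" for i j r
  proof (rule ccontr)
    assume "\<not> ?thesis"
    then have r: "r \<in> set (?G i)" "r \<in> set (?G j)" by auto
    obtain j' where j': "j = Suc j'" "j' < m" using \<open>i < j\<close> \<open>j < Suc m\<close> by (cases j) auto
    have Aij: "A i \<le> A j'" by (rule mono_upto[of m]) (use mono that j' in auto)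
    have lifted: "0 < snd s" if "s \<in> set (lift (F k))" "k < m" for s k
      using that snd_nonneg_schroeder_type_path[OF disjoint_pathsD[OF F]]
      by (fastforce simp: set_lift)
    have low: "fst r \<le> int (A i)" if "snd r = 0"
    proof -
      have "fst r \<le> fst (int (A i), 0::int)"
        using schroeder_type_path_monotone[OF path r(1)] \<open>i < j\<close> \<open>j < Suc m\<close> by simp
      then show ?thesis by simp
    qed
    show False
    \<comment> \<open>A common point on the bottom row would give
      \<open>fst r \<le> A i \<le> A j' < fst (c j') \<le> fst r\<close>. A higher one, moved down
      by one, would be common to two paths of \<open>F\<close>.\<close>
    proof (cases "r \<in> set (lift (F j'))")
      case False
      then have "snd r = 0" "int (fst (c j')) \<le> fst r"
        using r(2) j' by (auto simp: set_bottom_row)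
      then show False using low c'[OF j'(2)] Aij by simp
    next
      case True
      then have pos: "0 < snd r" using lifted j' by blast
      then obtain i' where i': "i = Suc i'" "i' < m"
        using r(1) \<open>i < j\<close> \<open>j < Suc m\<close> by (cases i) (auto simp: set_bottom_row)
      have "r \<in> set (lift (F i'))"
        using r(1) i' pos by (auto simp: set_bottom_row)
      with True have "\<exists>s. s \<in> set (F i') \<and> s \<in> set (F j')"
        by (force simp: set_lift)
      then show False
        using disjoint_paths_disjointD[OF F i'(2) j'(2)] that i' j' by auto
    qed
  qed
  have "r \<notin> set (?G i) \<or> r \<notin> set (?G j)" if "i \<noteq> j" "i < Suc m" "j < Suc m" for i j r
    using that disj[of i j r] disj[of j i r] by (meson nat_neq_iff)
  then show ?thesis
    using path by (auto simp: disjoint_paths_def disjoint_family_on_def supp_def attach_row_def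
      simp del: attach_row_0 attach_row_Suc)
qed

text \<open>Surjectivity of row attachment: the decomposition applies to each path of positive
  index, and disjointness makes the resulting abscissas valid crossings.\<close>

lemma disjoint_paths_SucE:
  assumes mono: "\<And>i. i < m \<Longrightarrow> A i \<le> A (Suc i)"
    and G: "G \<in> disjoint_paths (Suc m) A"
  obtains c F where "c \<in> PiE {..<m} (\<lambda>i. crossings (A i) (A (Suc i)))"
    "F \<in> disjoint_paths m (\<lambda>i. snd (c i))" "G = attach_row m A c F"
proof -
  have "\<forall>i. \<exists>b x P. i < m \<longrightarrow> b \<le> A (Suc i) \<and> int x \<in> {int b, int b - 1} \<and>
      schroeder_type_path (int x, 0) (0, int i) P \<and> G (Suc i) = bottom_row (A (Suc i)) b @ lift P"
  proof
    fix i
    show "\<exists>b x P. i < m \<longrightarrow> b \<le> A (Suc i) \<and> int x \<in> {int b, int b - 1} \<and>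
      schroeder_type_path (int x, 0) (0, int i) P \<and> G (Suc i) = bottom_row (A (Suc i)) b @ lift P"
    proof (cases "i < m")
      case True
      then have "schroeder_type_path (int (A (Suc i)), 0) (0, int (Suc i)) (G (Suc i))"
        by (intro disjoint_pathsD[OF G]) simp
      then show ?thesis
        by (rule schroeder_type_path_decompose) blast
    qed blast
  qed
  then obtain b x P where *: "\<And>i. i < m \<Longrightarrow> b i \<le> A (Suc i)"
    "\<And>i. i < m \<Longrightarrow> int (x i) \<in> {int (b i), int (b i) - 1}"
    "\<And>i. i < m \<Longrightarrow> schroeder_type_path (int (x i), 0) (0, int i) (P i)"
    "\<And>i. i < m \<Longrightarrow> G (Suc i) = bottom_row (A (Suc i)) (b i) @ lift (P i)"
    unfolding choice_iff by blast
  \<comment> \<open>Otherwise \<open>b i \<le> A i \<le> A (Suc i)\<close>, and the bottom segment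
    of path \<open>i + 1\<close> would contain the starting point of path \<open>i\<close>.\<close>
  have low: "A i < b i" if "i < m" for i
  proof (rule ccontr)
    assume "\<not> ?thesis"
    then have "(int (A i), 0) \<in> set (G (Suc i))"
      using that mono[of i] by (auto simp: *(4) set_bottom_row)
    moreover have "(int (A i), 0) \<in> set (G i)"
      using disjoint_pathsD[OF G, of i] that by (auto simp: schroeder_type_path_iff in_set_conv_nth hd_conv_nth)
    ultimately show False
      using disjoint_paths_disjointD[OF G, of i "Suc i"] that by auto
  qed
  define c where "c = (\<lambda>i\<in>{..<m}. (b i, x i))"
  define F where "F = restrict P {..<m}"
  have "c i \<in> crossings (A i) (A (Suc i))" if "i < m" for i
    using *(1,2)[OF that] low[OF that] that by (auto simp: c_def crossings_def)
  then have c: "c \<in> PiE {..<m} (\<lambda>i. crossings (A i) (A (Suc i)))"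
    by (auto simp: c_def)
  have "i = j" if "i < m" "j < m" "r \<in> set (P i)" "r \<in> set (P j)" for i j r
  proof -
    have "(\<lambda>(x, y). (x, y + 1)) r \<in> set (G (Suc i))" "(\<lambda>(x, y). (x, y + 1)) r \<in> set (G (Suc j))"
      using that by (simp_all add: *(4) set_lift)
    then show ?thesis
      using disjoint_paths_disjointD[OF G, of "Suc i" "Suc j"] that by auto
  qed
  then have F: "F \<in> disjoint_paths m (\<lambda>i. snd (c i))"
    using *(3) by (auto simp: disjoint_paths_def disjoint_family_on_def supp_def F_def c_def)
  have "G i = attach_row m A c F i" for i
  proof (cases "i < Suc m")
    case True
    then show ?thesis
      using disjoint_pathsD[OF G, of 0] schroeder_type_path_bottom[of "A 0"]
      by (cases i) (simp_all add: *(4) c_def F_def)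
  next
    case False
    then have "G i = undefined" using G by (auto simp: disjoint_paths_def PiE_def extensional_def)
    then show ?thesis using False by (simp add: attach_row_def)
  qed
  then show ?thesis using c F by (intro that[of c F]) auto
qed

text \<open>The sum is dependent because the entry abscissas in \<open>c\<close> are the starting
  abscissas of the smaller family.\<close>

lemma bij_betw_attach_row:
  assumes mono: "\<And>i. i < m \<Longrightarrow> A i \<le> A (Suc i)"
  shows "bij_betw (\<lambda>(c, F). attach_row m A c F)
    (SIGMA c : PiE {..<m} (\<lambda>i. crossings (A i) (A (Suc i))). disjoint_paths m (\<lambda>i. snd (c i)))
    (disjoint_paths (Suc m) A)"
  unfolding bij_betw_def
proof (intro conjI inj_onI equalityI subsetI)
  let ?C = "PiE {..<m} (\<lambda>i. crossings (A i) (A (Suc i)))"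
  let ?S = "SIGMA c : ?C. disjoint_paths m (\<lambda>i. snd (c i))"
  fix u v
  assume "u \<in> ?S" "v \<in> ?S" and eq: "(\<lambda>(c, F). attach_row m A c F) u = (\<lambda>(c, F). attach_row m A c F) v"
  then obtain c F c' F' where uv: "u = (c, F)" "v = (c', F')"
    and c: "c \<in> ?C" "c' \<in> ?C"
    and F: "F \<in> disjoint_paths m (\<lambda>i. snd (c i))" "F' \<in> disjoint_paths m (\<lambda>i. snd (c' i))"
    by auto
  have *: "c i = c' i \<and> F i = F' i" if "i < m" for i
  proof -
    have "bottom_row (A (Suc i)) (fst (c i)) @ lift (F i) =
        bottom_row (A (Suc i)) (fst (c' i)) @ lift (F' i)"
      using fun_cong[OF eq[unfolded uv prod.case], of "Suc i"] that by simp
    moreover have "c i \<in> crossings (A i) (A (Suc i))" "c' i \<in> crossings (A i) (A (Suc i))"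
      using c that by auto
    ultimately have "fst (c i) = fst (c' i) \<and> F i = F' i \<and> int (snd (c i)) = int (snd (c' i))"
      using disjoint_pathsD[OF F(1) that] disjoint_pathsD[OF F(2) that]
      by (intro bottom_row_append_lift_inj) (auto dest: crossingsD)
    then show ?thesis by (simp add: prod_eq_iff)
  qed
  have "c = c'" by (rule PiE_ext[OF c]) (use * in auto)
  moreover have "F \<in> extensional {..<m}" "F' \<in> extensional {..<m}"
    using F by (simp_all add: disjoint_paths_def PiE_def)
  then have "F = F'"
    by (rule extensionalityI) (simp add: *)
  ultimately show "u = v" by (simp add: uv)
next
  fix G
  assume "G \<in> (\<lambda>(c, F). attach_row m A c F) `
    (SIGMA c : PiE {..<m} (\<lambda>i. crossings (A i) (A (Suc i))). disjoint_paths m (\<lambda>i. snd (c i)))"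
  then show "G \<in> disjoint_paths (Suc m) A"
    by (auto intro: attach_row_in_disjoint_paths[where A = A, OF mono])
next
  fix G
  assume "G \<in> disjoint_paths (Suc m) A"
  then obtain c F where "c \<in> PiE {..<m} (\<lambda>i. crossings (A i) (A (Suc i)))"
    "F \<in> disjoint_paths m (\<lambda>i. snd (c i))" "G = attach_row m A c F"
    using disjoint_paths_SucE[where A = A, OF mono] by blast
  then show "G \<in> (\<lambda>(c, F). attach_row m A c F) `
    (SIGMA c : PiE {..<m} (\<lambda>i. crossings (A i) (A (Suc i))). disjoint_paths m (\<lambda>i. snd (c i)))"
    by (intro image_eqI[of _ _ "(c, F)"]) simp_all
qed

text \<open>Both sides are separated by \<open>A (Suc i)\<close>: the left is at most this value,
  while the next exit abscissa exceeds it and entering the next row loses at most 1. Equality can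
  occur.\<close>

lemma crossings_mono:
  assumes "c \<in> PiE {..<m} (\<lambda>i. crossings (A i) (A (Suc i)))" "Suc i < m"
  shows "snd (c i) \<le> snd (c (Suc i))"
proof -
  have "c i \<in> crossings (A i) (A (Suc i))" "c (Suc i) \<in> crossings (A (Suc i)) (A (Suc (Suc i)))"
    using PiE_mem[OF assms(1)] assms(2) by simp_all
  then show ?thesis by (auto simp: crossings_def)
qed

text \<open>Monotonicity is only weak here: if two starting points coincide, both sides vanish. Hence
  in the induction the two choices at each crossing are independent.\<close>

theorem card_disjoint_paths:
  assumes "\<And>i. Suc i < m \<Longrightarrow> A i \<le> A (Suc i)"
  shows "finite (disjoint_paths m A) \<and>
    int (card (disjoint_paths m A)) = 2 ^ (m choose 2) * binom_det m A"
  using assms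
proof (induction m arbitrary: A)
  case 0
  then show ?case
    by (simp add: disjoint_paths_def binom_det_def det_def disjoint_family_on_def)
next
  case (Suc m)
  let ?C = "PiE {..<m} (\<lambda>i. crossings (A i) (A (Suc i)))"
  have mono: "A i \<le> A (Suc i)" if "i < m" for i
    using Suc.prems that by simp
  have fin: "finite ?C" by (intro finite_PiE) auto
  have IH: "finite (disjoint_paths m (\<lambda>i. snd (c i)))"
    "int (card (disjoint_paths m (\<lambda>i. snd (c i)))) = 2 ^ (m choose 2) * binom_det m (\<lambda>i. snd (c i))"
    if "c \<in> ?C" for c
    using Suc.IH[of "\<lambda>i. snd (c i)"] crossings_mono[OF that] by blast+
  have bij: "bij_betw (\<lambda>(c, F). attach_row m A c F)
    (SIGMA c : ?C. disjoint_paths m (\<lambda>i. snd (c i))) (disjoint_paths (Suc m) A)"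
    using mono by (rule bij_betw_attach_row)
  have "card (disjoint_paths (Suc m) A) = (\<Sum>c\<in>?C. card (disjoint_paths m (\<lambda>i. snd (c i))))"
    using bij_betw_same_card[OF bij] card_SigmaI[of ?C "\<lambda>c. disjoint_paths m (\<lambda>i. snd (c i))"] fin IH(1)
    by simp
  then have "int (card (disjoint_paths (Suc m) A)) =
      (\<Sum>c\<in>?C. int (card (disjoint_paths m (\<lambda>i. snd (c i)))))"
    by simp
  also have "\<dots> = 2 ^ (m choose 2) * (\<Sum>c\<in>?C. binom_det m (\<lambda>i. snd (c i)))"
    by (simp add: IH(2) sum_distrib_left)
  \<comment> \<open>The factor \<open>2 ^ m\<close> from the crossings is absorbed by
    \<open>(m + 1 choose 2) = (m choose 2) + m\<close>.\<close>
  also have "\<dots> = 2 ^ (Suc m choose 2) * binom_det (Suc m) A"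
    by (simp add: sum_binom_det_crossings[where A = A, OF mono] numeral_2_eq_2 power_add mult_ac)
  finally show ?case
    using bij_betw_finite[OF bij] fin IH(1) by auto
qed

text \<open>Lifting raises both the index and \<open>k + l\<close> by one, so only bottom row points
  need an argument. Those on path \<open>i' + 1\<close> satisfy
  \<open>k \<ge> fst (c i') > A i' \<ge> i'\<close>.\<close>

lemma disjoint_paths_above_antidiagonal:
  assumes "\<And>i. Suc i < m \<Longrightarrow> A i \<le> A (Suc i)"
    and "F \<in> disjoint_paths m A" "i < m" "(k, l) \<in> set (F i)"
  shows "int i \<le> k + l"
  using assms
proof (induction m arbitrary: A F i k l)
  case (Suc m)
  have mono: "A i \<le> A (Suc i)" if "i < m" for i
    using Suc.prems(1) that by simp
  obtain c F' where c: "c \<in> PiE {..<m} (\<lambda>i. crossings (A i) (A (Suc i)))"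
    and F': "F' \<in> disjoint_paths m (\<lambda>i. snd (c i))" and F: "F = attach_row m A c F'"
    using disjoint_paths_SucE[where A = A, OF mono Suc.prems(2)] by blast
  have c': "A i < fst (c i)" "fst (c i) \<le> A (Suc i)" if "i < m" for i
    using crossingsD[OF PiE_mem[OF c]] that by simp_all
  \<comment> \<open>Valid crossings require \<open>A i < fst (c i) \<le> A (Suc i)\<close>, so
    \<open>A\<close> increases strictly up to index \<open>m\<close>.\<close>
  have A_ge: "i \<le> A i" if "i \<le> m" for i
    using that
  proof (induction i)
    case (Suc i)
    then show ?case using c'[of i] by simp
  qed simp
  show ?case
  proof (cases i)
    case 0
    then show ?thesis using Suc.prems(4) F by (auto simp: set_bottom_row)
  next
    case (Suc i')
    then have i': "i' < m" using Suc.prems(3) by simp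
    then consider "l = 0" "int (fst (c i')) \<le> k" | "(k, l - 1) \<in> set (F' i')"
      using Suc.prems(4) F Suc by (auto simp: set_bottom_row set_lift)
    then show ?thesis
    proof cases
      case 1
      then show ?thesis using c'[OF i'] A_ge[of i'] i' Suc by simp
    next
      case 2
      then have "int i' \<le> k + (l - 1)"
        using Suc.IH[of "\<lambda>i. snd (c i)" F' i' k "l - 1"] crossings_mono[OF c] F' i' by blast
      then show ?thesis using Suc by simp
    qed
  qed
qed simp

section \<open>The count for starting abscissas \<open>A i = i\<close>\<close>

theorem theorem2:
  fixes n :: nat
  shows "card {F. disjoint_schroeder_n_family n F} = 2 ^ (n choose 2)"
proof -
  \<comment> \<open>Lists of length \<open>n\<close> correspond to functions extensional on
    \<open>{..<n}\<close>. The Schroeder condition holds for every disjoint family here, so it does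
    not cut down the count.\<close>
  have "bij_betw (\<lambda>F. map F [0..<n]) (disjoint_paths n (\<lambda>i. i)) {F. disjoint_schroeder_n_family n F}"
  proof (rule bij_betwI[where g = "\<lambda>F. \<lambda>i\<in>{..<n}. F ! i"])
    show "(\<lambda>F. map F [0..<n]) \<in> disjoint_paths n (\<lambda>i. i) \<rightarrow> {F. disjoint_schroeder_n_family n F}"
    proof
      fix F assume F: "F \<in> disjoint_paths n (\<lambda>i. i)"
      have "int i \<le> k + l" if "i < n" "(k, l) \<in> set (F i)" for i k l
        using disjoint_paths_above_antidiagonal[OF _ F that] by simp
      then show "map F [0..<n] \<in> {F. disjoint_schroeder_n_family n F}"
        using F by (auto simp: disjoint_schroeder_n_family_def disjoint_n_family_def n_family_def
          schroeder_n_family_def disjoint_paths_def disjoint_family_on_def supp_def)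
    qed
  next
    show "(\<lambda>F. \<lambda>i\<in>{..<n}. F ! i) \<in> {F. disjoint_schroeder_n_family n F} \<rightarrow> disjoint_paths n (\<lambda>i. i)"
      by (auto simp: disjoint_schroeder_n_family_def disjoint_n_family_def n_family_def
          disjoint_paths_def disjoint_family_on_def)
  next
    fix F assume "F \<in> disjoint_paths n (\<lambda>i. i)"
    then show "(\<lambda>i\<in>{..<n}. map F [0..<n] ! i) = F"
      by (auto simp: disjoint_paths_def PiE_def extensional_def)
  next
    fix F assume "F \<in> {F. disjoint_schroeder_n_family n F}"
    then show "map (\<lambda>i\<in>{..<n}. F ! i) [0..<n] = F"
      by (auto simp: disjoint_schroeder_n_family_def disjoint_n_family_def n_family_def
        intro: nth_equalityI)
  qed
  then have "int (card {F. disjoint_schroeder_n_family n F}) = int (card (disjoint_paths n (\<lambda>i. i)))"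
    by (simp add: bij_betw_same_card)
  also have "\<dots> = 2 ^ (n choose 2)"
    using card_disjoint_paths[of n "\<lambda>i. i"] by (simp add: binom_det_id)
  finally show ?thesis by simp
qed

end
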